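(* Let $\mathcal{G}=\mathcal{G}(\mathbb{R}^{1,3})$ be the spacetime algebra and let $N_4\colon\mathcal{G}\to\mathbb{R}$ be given by $N_4(x) := [x^{\square}x]\,x^{\square}x$. Then $N_4(x^{\square}) = N_4(x)$ for all $x\in\mathcal{G}$.
   Context: $\mathcal{G}(\mathbb{R}^{1,3})$ is the $16$-dimensional associative unital real algebra (Clifford algebra) generated by an orthonormal basis $\gamma_0,\gamma_1,\gamma_2,\gamma_3$ of $\mathbb{R}^{1,3}$ with $\gamma_0^2=1$, $\gamma_1^2=\gamma_2^2=\gamma_3^2=-1$ and $\gamma_i\gamma_j=-\gamma_j\gamma_i$ for $i\ne j$. For $0\le k\le 4$, $\mathcal{G}^k$ is the span of the products $\gamma_{i_1}\cdots\gamma_{i_k}$ with $i_1<\dots<i_k$ (with $\mathcal{G}^0=\mathbb{R}$), so $\mathcal{G}=\bigoplus_{k=0}^4\mathcal{G}^k$. The Clifford conjugate $x\mapsto x^{\square}$ is the linear map acting on $\mathcal{G}^0,\mathcal{G}^1,\mathcal{G}^2,\mathcal{G}^3,\mathcal{G}^4$ as multiplication by $+1,-1,-1,+1,+1$ respectively; it satisfies $(xy)^{\square}=y^{\square}x^{\square}$. The map $x\mapsto[x]$ is the linear map which is the identity on $\mathcal{G}^0$ and multiplication by $-1$ on $\mathcal{G}^k$ for $k\ge1$. One has $x^{\square}x\in\mathcal{G}^0\oplus\mathcal{G}^3\oplus\mathcal{G}^4$, and $[Y]Y\in\mathbb{R}$ for every $Y$ in this subspace, so $N_4$ is real-valued. 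*)

theory Defs
  imports "HOL-Analysis.Analysis"
begin

section \<open>The spacetime algebra\<close>

text \<open>
  Concrete model of the Clifford algebra of signature (1,3). An element is given by its 16 real
  coordinates with respect to the basis blades \<open>\<gamma>\<^sub>A\<close> (the product of the generators with index
  in \<open>A\<close>, in increasing order), where \<open>A\<close> ranges over the subsets of \<open>{0,1,2,3}\<close>, the universe
  of the numeral type \<open>4\<close>.
\<close>

typedef sta = "UNIV :: (4 set \<Rightarrow> real) set"
  morphisms coeff Sta ..

lemma coeff_Sta [simp]: "coeff (Sta f) = f"
  by (simp add: Sta_inverse)

lemma sta_eq_iff: "x = y \<longleftrightarrow> (\<forall>A. coeff x A = coeff y A)"
  by (metis coeff_inject ext)

text \<open>
  Writing the product of the blades of \<open>A\<close> and \<open>B\<close> in increasing order moves every factor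
  \<open>\<gamma>\<^sub>i\<close> with \<open>i \<in> A\<close> past every \<open>\<gamma>\<^sub>j\<close> with \<open>j \<in> B\<close>, \<open>j < i\<close>, each time with a factor \<open>-1\<close>,
  and contracts every \<open>\<gamma>\<^sub>i\<close> with \<open>i \<in> A \<inter> B\<close> to its square.
\<close>

definition pair_sign :: "4 \<Rightarrow> 4 \<Rightarrow> real" where
  "pair_sign i j = (if j < i then -1 else if i = j then (if i = 0 then 1 else -1) else 1)"

definition blade_sign :: "4 set \<Rightarrow> 4 set \<Rightarrow> real" where
  "blade_sign A B = (\<Prod>i\<in>A. \<Prod>j\<in>B. pair_sign i j)"

instantiation sta :: "{zero, one, plus, minus, uminus, times, scaleR}"
begin

definition "0 = Sta (\<lambda>A. 0)"
definition "1 = Sta (\<lambda>A. if A = {} then 1 else 0)"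
definition "x + y = Sta (\<lambda>A. coeff x A + coeff y A)"
definition "x - y = Sta (\<lambda>A. coeff x A - coeff y A)"
definition "- x = Sta (\<lambda>A. - coeff x A)"
definition "r *\<^sub>R x = Sta (\<lambda>A. r * coeff x A)"
definition "x * y =
  Sta (\<lambda>C. \<Sum>(A, B) | sym_diff A B = C. blade_sign A B * coeff x A * coeff y B)"

instance ..

end

lemma coeff_simps [simp]:
  "coeff 0 A = 0"
  "coeff 1 A = (if A = {} then 1 else 0)"
  "coeff (x + y) A = coeff x A + coeff y A"
  "coeff (x - y) A = coeff x A - coeff y A"
  "coeff (- x) A = - coeff x A"
  "coeff (r *\<^sub>R x) A = r * coeff x A"
  by (simp_all add: zero_sta_def one_sta_def plus_sta_def minus_sta_def uminus_sta_def
      scaleR_sta_def)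

lemma coeff_times:
  "coeff (x * y) C = (\<Sum>A\<in>UNIV. blade_sign A (sym_diff A C) * coeff x A * coeff y (sym_diff A C))"
  unfolding times_sta_def coeff_Sta
proof (rule sum.reindex_bij_witness[of _ "\<lambda>A. (A, sym_diff A C)" fst], goal_cases)
  case (5 p)
  moreover have "sym_diff a (sym_diff a b) = b" for a b :: "4 set" by auto
  ultimately show ?case by (auto simp only: case_prod_beta mem_Collect_eq)
qed auto

lemma pair_sign_square [simp]: "pair_sign i j * pair_sign i j = 1"
  by (simp add: pair_sign_def)

lemma prod_sym_diff:
  fixes f :: "4 \<Rightarrow> real"
  assumes "\<And>i. f i * f i = 1"
  shows "prod f (sym_diff A B) = prod f A * prod f B"
proof -
  have 1: "prod f (A \<inter> B) * prod f (A \<inter> B) = 1"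
    by (simp add: assms flip: prod.distrib)
  have A: "prod f A = prod f (A - B) * prod f (A \<inter> B)"
    by (metis Int_Diff_Un Int_Diff_disjoint finite mult.commute prod.union_disjoint)
  have B: "prod f B = prod f (B - A) * prod f (A \<inter> B)"
    by (metis Int_Diff_Un Int_Diff_disjoint Int_commute finite mult.commute prod.union_disjoint)
  have "prod f (sym_diff A B) = prod f (A - B) * prod f (B - A)"
    by (rule prod.union_disjoint) auto
  also have "\<dots> = prod f A * prod f B"
    unfolding A B using 1 by (simp add: algebra_simps)
  finally show ?thesis .
qed

lemma blade_sign_sym_diff_right: "blade_sign A (sym_diff B C) = blade_sign A B * blade_sign A C"
  by (simp add: blade_sign_def prod_sym_diff prod.distrib)

lemma blade_sign_sym_diff_left: "blade_sign (sym_diff A B) C = blade_sign A C * blade_sign B C"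
  unfolding blade_sign_def by (rule prod_sym_diff) (simp flip: prod.distrib)

lemma blade_sign_empty [simp]: "blade_sign {} A = 1" "blade_sign A {} = 1"
  by (simp_all add: blade_sign_def)

lemma sym_diff_simps:
  "sym_diff A (sym_diff A B) = B" "sym_diff (sym_diff A B) B = A"
  "sym_diff (sym_diff A B) (sym_diff A C) = sym_diff B C"
  by auto

lemma mult_assoc_sta: "x * y * z = x * (y * z)" for x y z :: sta
proof -
  have "coeff (x * y * z) D = coeff (x * (y * z)) D" for D
  proof -
    let ?t = "\<lambda>A B C. blade_sign A B * blade_sign A C * blade_sign B C
      * coeff x A * coeff y B * coeff z C"
    have "coeff (x * y * z) D =
      (\<Sum>E\<in>UNIV. \<Sum>A\<in>UNIV. blade_sign E (sym_diff E D) * blade_sign A (sym_diff A E)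
        * coeff x A * coeff y (sym_diff A E) * coeff z (sym_diff E D))"
      by (simp add: coeff_times sum_distrib_left sum_distrib_right mult_ac)
    also have "\<dots> = (\<Sum>A\<in>UNIV. \<Sum>E\<in>UNIV. blade_sign E (sym_diff E D) * blade_sign A (sym_diff A E)
        * coeff x A * coeff y (sym_diff A E) * coeff z (sym_diff E D))"
      by (rule sum.swap)
    also have "\<dots> = (\<Sum>A\<in>UNIV. \<Sum>B\<in>UNIV. ?t A B (sym_diff (sym_diff A B) D))"
    proof (rule sum.cong[OF refl])
      fix A
      show "(\<Sum>E\<in>UNIV. blade_sign E (sym_diff E D) * blade_sign A (sym_diff A E)
        * coeff x A * coeff y (sym_diff A E) * coeff z (sym_diff E D))
        = (\<Sum>B\<in>UNIV. ?t A B (sym_diff (sym_diff A B) D))"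
      proof (rule sum.reindex_bij_witness[of _ "sym_diff A" "sym_diff A"], goal_cases)
        case (5 E)
        have "blade_sign E (sym_diff E D)
          = blade_sign A (sym_diff E D) * blade_sign (sym_diff A E) (sym_diff E D)"
          by (subst blade_sign_sym_diff_left[symmetric]) (simp only: sym_diff_simps)
        then show ?case by (simp only: sym_diff_simps mult_ac)
      qed (simp_all only: sym_diff_simps UNIV_I)
    qed
    also have "\<dots> = (\<Sum>A\<in>UNIV. \<Sum>E\<in>UNIV. blade_sign A (sym_diff A D)
        * coeff x A * (blade_sign E (sym_diff E (sym_diff A D)) * coeff y E
        * coeff z (sym_diff E (sym_diff A D))))"
    proof (intro sum.cong refl)
      fix A B
      have eq: "sym_diff (sym_diff A B) D = sym_diff B (sym_diff A D)" by auto
      have "blade_sign A (sym_diff A D)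
        = blade_sign A B * blade_sign A (sym_diff B (sym_diff A D))"
        by (subst blade_sign_sym_diff_right[symmetric]) (simp only: sym_diff_simps)
      then show "?t A B (sym_diff (sym_diff A B) D) = blade_sign A (sym_diff A D)
        * coeff x A * (blade_sign B (sym_diff B (sym_diff A D)) * coeff y B
        * coeff z (sym_diff B (sym_diff A D)))"
        unfolding eq by (simp only: mult_ac)
    qed
    also have "\<dots> = coeff (x * (y * z)) D"
      by (simp add: coeff_times sum_distrib_left)
    finally show ?thesis .
  qed
  then show ?thesis by (simp add: sta_eq_iff)
qed

instance sta :: real_algebra_1
proof
  fix x y z :: sta and a b :: real
  show "x * y * z = x * (y * z)" by (rule mult_assoc_sta)
  have "coeff (1 * x) C = coeff x C" for C
  proof -
    have "coeff (1 * x) C = (\<Sum>A\<in>{{}}. blade_sign A (sym_diff A C) * coeff 1 A * coeff x (sym_diff A C))"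
      unfolding coeff_times by (rule sum.mono_neutral_right) auto
    then show ?thesis by simp
  qed
  then show "1 * x = x" by (simp add: sta_eq_iff)
  have "coeff (x * 1) C = coeff x C" for C
  proof -
    have "coeff (x * 1) C = (\<Sum>A\<in>{C}. blade_sign A (sym_diff A C) * coeff x A * coeff 1 (sym_diff A C))"
      unfolding coeff_times by (rule sum.mono_neutral_right) auto
    then show ?thesis by simp
  qed
  then show "x * 1 = x" by (simp add: sta_eq_iff)
  show "(0 :: sta) \<noteq> 1" by (auto simp: sta_eq_iff)
qed (simp_all add: sta_eq_iff coeff_times sum.distrib sum_distrib_left algebra_simps)

subsection \<open>Generators, blades and grades\<close>

definition gam :: "4 \<Rightarrow> sta" where
  "gam i = Sta (\<lambda>A. if A = {i} then 1 else 0)"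

definition blade :: "4 set \<Rightarrow> sta" where
  "blade A = prod_list (map gam (sorted_list_of_set A))"

definition grade :: "nat \<Rightarrow> sta set" where
  "grade k = span {blade A |A. card A = k}"

lemma basis_mult:
  "Sta (\<lambda>C. if C = A then 1 else 0) * Sta (\<lambda>C. if C = B then 1 else 0)
    = blade_sign A B *\<^sub>R Sta (\<lambda>C. if C = sym_diff A B then 1 else 0)"
proof -
  have "coeff (Sta (\<lambda>C. if C = A then 1 else 0) * Sta (\<lambda>C. if C = B then 1 else 0)) C
    = (if C = sym_diff A B then blade_sign A B else 0)" for C
  proof -
    have "coeff (Sta (\<lambda>C. if C = A then 1 else 0) * Sta (\<lambda>C. if C = B then 1 else 0)) C
      = (\<Sum>D\<in>{A}. blade_sign D (sym_diff D C) * (if D = A then 1 else 0) *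
          (if sym_diff D C = B then 1 else 0))"
      unfolding coeff_times coeff_Sta by (rule sum.mono_neutral_right) auto
    moreover have "sym_diff A C = B \<longleftrightarrow> C = sym_diff A B" by auto
    ultimately show ?thesis by auto
  qed
  then show ?thesis by (simp add: sta_eq_iff)
qed

lemma gam_square: "gam i * gam i = (if i = 0 then 1 else - 1)"
  unfolding gam_def basis_mult by (simp add: sta_eq_iff blade_sign_def pair_sign_def)

lemma gam_anticommute:
  assumes "i \<noteq> j"
  shows "gam i * gam j = - (gam j * gam i)"
proof -
  have "sym_diff {i} {j} = sym_diff {j} {i}" by auto
  moreover have "pair_sign i j = - pair_sign j i"
    using assms by (auto simp: pair_sign_def)
  ultimately show ?thesis
    unfolding gam_def basis_mult by (simp add: sta_eq_iff blade_sign_def)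
qed

lemma coeff_blade: "coeff (blade A) C = (if C = A then 1 else 0)"
proof -
  have "prod_list (map gam xs) = Sta (\<lambda>C. if C = set xs then 1 else 0)"
    if "sorted_wrt (<) xs" for xs
    using that
  proof (induction xs)
    case Nil
    then show ?case by (simp add: one_sta_def)
  next
    case (Cons i xs)
    have "pair_sign i j = 1" if "j \<in> set xs" for j
    proof -
      have "i < j" using Cons.prems that by simp
      then have "\<not> j < i" "i \<noteq> j" by auto
      then show ?thesis by (simp add: pair_sign_def)
    qed
    then have "blade_sign {i} (set xs) = 1"
      by (simp add: blade_sign_def)
    moreover have "sym_diff {i} (set xs) = insert i (set xs)"
      using Cons.prems by auto
    ultimately show ?case
      using Cons by (simp add: gam_def basis_mult del: Un_insert_left)
  qed
  then show ?thesis by (simp add: blade_def)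
qed

lemma sta_expand: "x = (\<Sum>A\<in>UNIV. coeff x A *\<^sub>R blade A)"
proof -
  have sum: "coeff (sum f I) C = (\<Sum>i\<in>I. coeff (f i) C)" for f :: "'i \<Rightarrow> sta" and I C
    by (induction I rule: infinite_finite_induct) auto
  have "coeff (\<Sum>A\<in>UNIV. coeff x A *\<^sub>R blade A) C = coeff x C" for C
    by (simp add: sum coeff_blade if_distrib cong: if_cong)
  then show ?thesis by (simp add: sta_eq_iff)
qed

lemma grade_iff: "x \<in> grade k \<longleftrightarrow> (\<forall>A. card A \<noteq> k \<longrightarrow> coeff x A = 0)"
proof
  assume "x \<in> grade k"
  then show "\<forall>A. card A \<noteq> k \<longrightarrow> coeff x A = 0"
    unfolding grade_def
    by (induction rule: span_induct_alt) (auto simp: coeff_blade split: if_splits)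
next
  assume *: "\<forall>A. card A \<noteq> k \<longrightarrow> coeff x A = 0"
  have "(\<Sum>A\<in>UNIV. coeff x A *\<^sub>R blade A) \<in> grade k"
    unfolding grade_def
  proof (rule span_sum)
    fix A
    show "coeff x A *\<^sub>R blade A \<in> span {blade A |A. card A = k}"
    proof (cases "card A = k")
      case True
      then have "blade A \<in> {blade A |A. card A = k}" by blast
      then show ?thesis by (intro span_scale span_base)
    next
      case False
      then show ?thesis using * by (simp add: span_zero)
    qed
  qed
  then show "x \<in> grade k" using sta_expand[of x] by simp
qed

lemma span_blades: "span (range blade) = UNIV"
proof -
  have "x \<in> span (range blade)" for x
    by (subst sta_expand) (blast intro: span_sum span_scale span_base)
  then show ?thesis by auto
qed

lemma inj_blade: "inj blade"
  by (rule injI) (metis coeff_blade zero_neq_one)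

lemma independent_blades: "independent (range blade)"
proof -
  have sum: "coeff (sum f I) C = (\<Sum>i\<in>I. coeff (f i) C)" for f :: "'i \<Rightarrow> sta" and I C
    by (induction I rule: infinite_finite_induct) auto
  have "u (blade C) = 0" if "(\<Sum>v\<in>range blade. u v *\<^sub>R v) = 0" for u C
  proof -
    have "0 = coeff (\<Sum>A\<in>UNIV. u (blade A) *\<^sub>R blade A) C"
      using that by (simp add: sum.reindex[OF inj_blade])
    also have "\<dots> = u (blade C)"
      by (simp add: sum coeff_blade if_distrib cong: if_cong)
    finally show ?thesis by simp
  qed
  then show ?thesis by (subst independent_if_scalars_zero) auto
qed

lemma dim_sta: "dim (UNIV :: sta set) = 16"
proof -
  have "dim (UNIV :: sta set) = card (range blade)"
    by (metis dim_eq_card independent_blades span_UNIV span_blades)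
  also have "\<dots> = card (UNIV :: 4 set set)"
    by (rule card_image[OF inj_blade])
  also have "\<dots> = 16"
    using card_Pow[of "UNIV :: 4 set"] by (simp add: Pow_UNIV)
  finally show ?thesis .
qed

section \<open>Clifford conjugation and the form \<open>N\<^sub>4\<close>\<close>

definition clifford_conj :: "sta \<Rightarrow> sta" where
  "clifford_conj x = Sta (\<lambda>A. if card A \<in> {1, 2} then - coeff x A else coeff x A)"

definition scalar_conj :: "sta \<Rightarrow> sta" where
  "scalar_conj x = Sta (\<lambda>A. if card A = 0 then coeff x A else - coeff x A)"

definition scalar_part :: "sta \<Rightarrow> real" where
  "scalar_part x = coeff x {}"

text \<open>
  The product below is a real multiple of \<open>1\<close> (lemma \<open>of_real_N4\<close>), so that taking its scalar
  part only turns it from an element of \<open>\<G>\<^sup>0\<close> into a real number.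
\<close>

definition N4 :: "sta \<Rightarrow> real" where
  "N4 x = scalar_part (scalar_conj (clifford_conj x * x) * (clifford_conj x * x))"

lemma linear_clifford_conj: "linear clifford_conj"
  by (rule linearI) (auto simp: sta_eq_iff clifford_conj_def)

lemma clifford_conj_grade:
  assumes "x \<in> grade k"
  shows "clifford_conj x = (if k \<in> {1, 2} then - x else x)"
  using assms by (auto simp: grade_iff sta_eq_iff clifford_conj_def)

lemma linear_scalar_conj: "linear scalar_conj"
  by (rule linearI) (auto simp: sta_eq_iff scalar_conj_def)

lemma scalar_conj_grade:
  assumes "x \<in> grade k"
  shows "scalar_conj x = (if k = 0 then x else - x)"
  using assms by (auto simp: grade_iff sta_eq_iff scalar_conj_def)

lemma blade_sign_swap:
  "blade_sign A B * blade_sign B A = (-1) ^ (card A * card B + card (A \<inter> B))"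
proof -
  have "blade_sign A B * blade_sign B A = (\<Prod>i\<in>A. \<Prod>j\<in>B. pair_sign i j * pair_sign j i)"
    unfolding blade_sign_def prod.swap[of "\<lambda>i j. pair_sign i j" A B]
    by (simp add: prod.distrib prod.swap[of "\<lambda>i j. pair_sign j i" B A])
  also have "\<dots> = (\<Prod>i\<in>A. \<Prod>j\<in>B. (-1) * (if i = j then -1 else 1))"
    by (intro prod.cong refl) (auto simp: pair_sign_def)
  also have "\<dots> = (\<Prod>i\<in>A. (-1) ^ card B * (if i \<in> B then -1 else 1))"
    by (simp only: prod.distrib prod_constant prod.delta'[OF finite] prod.delta[OF finite])
  also have "\<dots> = (-1) ^ (card A * card B) * (\<Prod>i\<in>A. if i \<in> B then -1 else 1)"
    by (simp add: prod.distrib power_mult[symmetric] mult.commute)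
  also have "(\<Prod>i\<in>A. if i \<in> B then -1 else (1::real)) = (-1) ^ card (A \<inter> B)"
    by (simp add: prod.If_cases Int_def)
  finally show ?thesis by (simp add: power_add)
qed

lemma card_4_le: "card (A :: 4 set) \<le> 4"
  using card_mono[of UNIV A] by simp

lemma le_4_cases:
  fixes n :: nat
  assumes "n \<le> 4"
  obtains "n = 0" | "n = 1" | "n = 2" | "n = 3" | "n = 4"
  using assms by arith

lemma card_sym_diff_4: "card (sym_diff A B) + 2 * card (A \<inter> B) = card A + card (B :: 4 set)"
proof -
  have "card (sym_diff A B) = card (A - B) + card (B - A)"
    by (rule card_Un_disjoint) auto
  moreover have "card A = card (A \<inter> B) + card (A - B)"
    by (rule card_Int_Diff) simp
  moreover have "card B = card (A \<inter> B) + card (B - A)"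
    by (metis card_Int_Diff finite Int_commute)
  ultimately show ?thesis by simp
qed

definition conj_sign :: "4 set \<Rightarrow> real" where
  "conj_sign A = (if card A \<in> {1, 2} then -1 else 1)"

lemma coeff_clifford_conj: "coeff (clifford_conj x) A = conj_sign A * coeff x A"
  by (simp add: clifford_conj_def conj_sign_def)

lemma blade_sign_square: "blade_sign A B * blade_sign A B = 1"
  by (simp add: blade_sign_def flip: prod.distrib)

lemma conj_sign_blade_sign:
  "conj_sign (sym_diff A B) * blade_sign A B = conj_sign A * conj_sign B * blade_sign B A"
proof -
  define a b m n where "a = card A" and "b = card B" and "m = card (A \<inter> B)"
    and "n = card (sym_diff A B)"
  note defs = this
  have le: "a \<le> 4" "b \<le> 4" "m \<le> 4" "m \<le> a" "m \<le> b" "n \<le> 4"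
    unfolding defs by (simp_all only: card_4_le) (simp_all add: card_mono)
  have "n + 2 * m = a + b"
    unfolding defs by (rule card_sym_diff_4)
  then have n: "n = a + b - 2 * m" by simp
  have "(if n \<in> {1, 2} then -1 else 1 :: real)
    = (if a \<in> {1, 2} then -1 else 1) * (if b \<in> {1, 2} then -1 else 1) * (-1) ^ (a * b + m)"
    using le(4-6) unfolding n
    by - (rule le_4_cases[OF le(1)]; rule le_4_cases[OF le(2)]; rule le_4_cases[OF le(3)];
        clarsimp)
  then have *: "conj_sign (sym_diff A B)
    = conj_sign A * conj_sign B * (-1) ^ (card A * card B + card (A \<inter> B))"
    unfolding defs conj_sign_def .
  show ?thesis
    unfolding * blade_sign_swap[symmetric]
    using blade_sign_square[of A B] by (simp add: mult_ac)
qed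

lemma clifford_conj_mult: "clifford_conj (x * y) = clifford_conj y * clifford_conj x"
proof -
  have "coeff (clifford_conj (x * y)) C = coeff (clifford_conj y * clifford_conj x) C" for C
  proof -
    have "coeff (clifford_conj (x * y)) C = (\<Sum>A\<in>UNIV. conj_sign C * blade_sign A (sym_diff A C)
        * coeff x A * coeff y (sym_diff A C))"
      by (simp add: coeff_clifford_conj coeff_times sum_distrib_left mult_ac)
    also have "\<dots> = (\<Sum>A\<in>UNIV. blade_sign A (sym_diff A C) * coeff (clifford_conj y) A
        * coeff (clifford_conj x) (sym_diff A C))"
    proof (rule sum.reindex_bij_witness[of _ "\<lambda>A. sym_diff A C" "\<lambda>A. sym_diff A C"], goal_cases)
      case (5 A)
      show ?case
        using conj_sign_blade_sign[of A "sym_diff A C"]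
        by (simp only: sym_diff_simps coeff_clifford_conj) (simp add: mult_ac)
    qed (simp_all only: sym_diff_simps UNIV_I)
    also have "\<dots> = coeff (clifford_conj y * clifford_conj x) C"
      by (simp only: coeff_times)
    finally show ?thesis .
  qed
  then show ?thesis by (simp add: sta_eq_iff)
qed

lemma clifford_conj_clifford_conj: "clifford_conj (clifford_conj x) = x"
  by (simp add: sta_eq_iff clifford_conj_def)

lemma coeff_self_conj:
  assumes "card A \<in> {1, 2}"
  shows "coeff (clifford_conj x * x) A = 0"
proof -
  have "clifford_conj (clifford_conj x * x) = clifford_conj x * x"
    by (simp add: clifford_conj_mult clifford_conj_clifford_conj)
  then have "coeff (clifford_conj (clifford_conj x * x)) A = coeff (clifford_conj x * x) A"
    by (rule arg_cong)
  then show ?thesis using assms by (auto simp: clifford_conj_def)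
qed

lemma blade_sign_anticommute:
  assumes "card A \<in> {3, 4}" "card B \<in> {3, 4}" "A \<noteq> (B :: 4 set)"
  shows "blade_sign B A = - blade_sign A B"
proof -
  have "card (A \<union> B) + card (A \<inter> B) = card A + card B"
    by (rule card_Un_Int[symmetric]) auto
  moreover have "card (A \<union> B) \<le> 4" by (rule card_4_le)
  moreover have "card (A \<inter> B) < card A \<or> card (A \<inter> B) < card B"
  proof -
    have "A \<inter> B \<subset> A \<or> A \<inter> B \<subset> B" using assms(3) by blast
    then show ?thesis by (auto intro: psubset_card_mono)
  qed
  moreover have "card (A \<inter> B) \<le> card A" "card (A \<inter> B) \<le> card B"
    by (simp_all add: card_mono)
  ultimately have "card A = 3 \<and> card B = 3 \<and> card (A \<inter> B) = 2
    \<or> card A = 3 \<and> card B = 4 \<and> card (A \<inter> B) = 3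
    \<or> card A = 4 \<and> card B = 3 \<and> card (A \<inter> B) = 3"
    using assms(1,2) unfolding insert_iff empty_iff by arith
  then have "odd (card A * card B + card (A \<inter> B))" by auto
  then have "blade_sign A B * blade_sign B A = -1"
    by (simp add: blade_sign_swap)
  then have "blade_sign A B * (blade_sign A B * blade_sign B A) = - blade_sign A B"
    by simp
  then show ?thesis
    using blade_sign_square[of A B] by (simp flip: mult.assoc)
qed

lemma scalar_conj_mult_self:
  assumes "\<And>A. card A \<in> {1, 2} \<Longrightarrow> coeff Y A = 0"
  shows "of_real (scalar_part (scalar_conj Y * Y)) = scalar_conj Y * Y"
proof -
  have "coeff (scalar_conj Y * Y) C = 0" if C: "C \<noteq> {}" for C
  proof -
    let ?f = "\<lambda>A. blade_sign A (sym_diff A C) * coeff (scalar_conj Y) A * coeff Y (sym_diff A C)"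
    have neg: "?f (sym_diff A C) = - ?f A" for A
    proof -
      let ?B = "sym_diff A C"
      have AB: "A \<noteq> ?B" using C by auto
      have f: "?f ?B = blade_sign ?B A * coeff (scalar_conj Y) ?B * coeff Y A"
        by (simp only: sym_diff_simps)
      consider "A = {}" | "A \<noteq> {}" "?B = {}" | "coeff Y A = 0 \<or> coeff Y ?B = 0"
        | "card A \<in> {3, 4}" "card ?B \<in> {3, 4}"
      proof -
        have "A = {} \<or> coeff Y A = 0 \<or> card A \<in> {3, 4}" for A
          using assms[of A] by (rule_tac le_4_cases[OF card_4_le[of A]]) auto
        then show ?thesis using that by metis
      qed
      then show ?thesis
      proof cases
        case 1
        then show ?thesis using C by (simp add: scalar_conj_def)
      next
        case 2
        then have "A = C" by auto
        then show ?thesis using C by (simp add: scalar_conj_def)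
      next
        case 3
        then show ?thesis unfolding f by (auto simp: scalar_conj_def)
      next
        case 4
        then have "blade_sign ?B A = - blade_sign A ?B"
          using AB by (intro blade_sign_anticommute)
        then show ?thesis
          unfolding f using 4 by (auto simp: scalar_conj_def)
      qed
    qed
    have "sum ?f UNIV = (\<Sum>A\<in>UNIV. ?f (sym_diff A C))"
      by (rule sum.reindex_bij_witness[of _ "\<lambda>A. sym_diff A C" "\<lambda>A. sym_diff A C"])
        (simp_all only: sym_diff_simps UNIV_I)
    also have "\<dots> = - sum ?f UNIV"
      by (simp only: neg sum_negf)
    finally show ?thesis by (simp add: coeff_times)
  qed
  then show ?thesis by (simp add: sta_eq_iff of_real_def scalar_part_def)
qed

lemma of_real_N4: "of_real (N4 x) = scalar_conj (clifford_conj x * x) * (clifford_conj x * x)"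
  unfolding N4_def by (rule scalar_conj_mult_self) (rule coeff_self_conj)

end

theory Submission
  imports Defs
begin

text \<open>
  The scalar part is a trace: it is linear and invariant under exchanging two factors. Since
  \<open>[Y] = 2s - Y\<close> with \<open>s\<close> the scalar part of \<open>Y\<close>, the scalar part of \<open>[Y] Y\<close> is a polynomial
  in the traces of \<open>Y\<close> and \<open>Y\<^sup>2\<close>, and by cyclicity these agree for the two products of \<open>x\<close> and
  its conjugate.
\<close>

text \<open>Only products of a blade with itself reach the coefficient at \<open>{}\<close>, so the
  scalar part is a symmetric bilinear form in \<open>x\<close> and \<open>y\<close>.\<close>

lemma scalar_part_mult_commute: "scalar_part (x * y) = scalar_part (y * x)"
  by (simp add: scalar_part_def coeff_times mult_ac)

lemma scalar_conj_eq: "scalar_conj y = (2 * scalar_part y) *\<^sub>R 1 - y"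
  by (auto simp: sta_eq_iff scalar_conj_def scalar_part_def)

lemma scalar_part_scalar_conj_mult:
  "scalar_part (scalar_conj y * y) = 2 * (scalar_part y)\<^sup>2 - scalar_part (y * y)"
  by (simp add: scalar_conj_eq left_diff_distrib) (simp add: scalar_part_def power2_eq_square)

lemma scalar_part_scalar_conj_mult_commute:
  "scalar_part (scalar_conj (x * y) * (x * y)) = scalar_part (scalar_conj (y * x) * (y * x))"
proof -
  have "scalar_part (x * y * (x * y)) = scalar_part (y * x * (y * x))"
    \<comment> \<open>Cyclicity: the leading \<open>x\<close> of the word \<open>x y x y\<close>
      moves to its end.\<close>
    using scalar_part_mult_commute[of x "y * (x * y)"] by (simp add: mult.assoc)
  then show ?thesis
    by (simp add: scalar_part_scalar_conj_mult scalar_part_mult_commute[of x y])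
qed

theorem theorem5p2:
  fixes x :: sta
  shows "N4 (clifford_conj x) = N4 x"
  \<comment> \<open>As conjugation is an involution, the left side is built from
    \<open>x * clifford_conj x\<close>, the right side from the same factors swapped.\<close>
  unfolding N4_def clifford_conj_clifford_conj by (rule scalar_part_scalar_conj_mult_commute)

end
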